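(* Let $a,b,\tau$ be positive integers such that $a<b$. If $1\le\tau<(b-a)/2$, then for all integers $n\ge a+\tau+1$, $$\mathrm{aw}\big(\mathcal{T}_\tau(n;a,b)\big)=-\left\lfloor\frac{n-(a+\tau+1)}{a}\right\rfloor.$$
   Context: Games are short two-player combinatorial games (players Left and Right) under normal play: a player unable to move on their turn loses. Truncated Support (TS): for positive integers $a<b$ and an integer truncation level $\tau$ with $1\le\tau<b$, and a heap size $n\ge0$, $\mathcal{T}_\tau(n;a,b)$ is the game played on one heap of $n$ pebbles in which Left, on her turn, may remove any number $i\in\{1,\dots,a\}$ of pebbles with $i\le n$, and Right, on his turn, may remove any number $j\in\{\tau+1,\dots,b\}$ with $j\le n$. Atomic weight: $*m$ denotes the nimber of size $m$, with $*0=0$ and $*=*1$. Up is $\uparrow=\{0\mid *\}$ and down is $\downarrow=-\uparrow=\{*\mid 0\}$. For an integer $w$, $w\cdot\uparrow$ is the disjunctive sum of $w$ copies of $\uparrow$ if $w\ge 0$, and of $|w|$ copies of $\downarrow$ if $w<0$. Far star, written ☆, stands for a nimber $*m$ whose birthday is larger than that of the games added to it (i.e. $m$ sufficiently large). Two games $G,H$ are equivalent under ☆, written $G\sim_{☆}H$, if for every short game $X$ the outcomes of $G+X+☆$ and $H+X+☆$ coincide. Equivalently, $\downarrow+☆<G-H<\uparrow+☆$. For an integer $w$, $\mathrm{aw}(G)=w$ means that $G$ is atomic with $G\sim_{☆}w\cdot\uparrow$; such a $w$ is unique if it exists. (TS games need not be all-small, so existence of the atomic weight is part of the assertion.) *)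

theory Defs
  imports Complex_Main "HOL-Library.FSet"
begin

declare fimage_cong [fundef_cong]

text \<open>
  Game trees with finitely many options at every position are exactly the short games.
\<close>

datatype game = Game (left_opts: "game fset") (right_opts: "game fset")

definition options :: "game \<Rightarrow> game fset" where
  "options G = left_opts G |\<union>| right_opts G"

text \<open>
  The formal birthday, i.e. the height of the game tree.
\<close>

primrec birthday :: "game \<Rightarrow> nat" where
  "birthday (Game L R) = Max (insert 0 (Suc ` fset (birthday |`| L |\<union>| birthday |`| R)))"

lemma birthday_option_less:
  assumes "H |\<in>| options G"
  shows "birthday H < birthday G"
proof (cases G)
  case (Game L R)
  let ?S = "insert 0 (Suc ` fset (birthday |`| L |\<union>| birthday |`| R))"
  have "Suc (birthday H) \<in> ?S"
    using assms Game by (auto simp: options_def)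
  moreover have "finite ?S"
    by (intro finite.insertI finite_imageI finite_fset)
  ultimately have "Suc (birthday H) \<le> Max ?S"
    by (intro Max_ge)
  then show ?thesis
    using Game by simp
qed

lemma birthday_left_option_less: "H |\<in>| left_opts G \<Longrightarrow> birthday H < birthday G"
  by (rule birthday_option_less) (simp add: options_def)

lemma birthday_right_option_less: "H |\<in>| right_opts G \<Longrightarrow> birthday H < birthday G"
  by (rule birthday_option_less) (simp add: options_def)

instantiation game :: "{zero, plus, uminus}"
begin

definition zero_game :: game where
  "0 = Game {||} {||}"

function plus_game :: "game \<Rightarrow> game \<Rightarrow> game" where
  "plus_game G H =
     Game ((\<lambda>G'. plus_game G' H) |`| left_opts G |\<union>| (\<lambda>H'. plus_game G H') |`| left_opts H)
          ((\<lambda>G'. plus_game G' H) |`| right_opts G |\<union>| (\<lambda>H'. plus_game G H') |`| right_opts H)"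
  by pat_completeness auto
termination
  by (relation "measure (\<lambda>(G, H). birthday G + birthday H)")
     (auto simp: birthday_left_option_less birthday_right_option_less)

primrec uminus_game :: "game \<Rightarrow> game" where
  "uminus_game (Game L R) = Game (uminus_game |`| R) (uminus_game |`| L)"

instance ..

end

declare plus_game.simps [simp del]

text \<open>
  Normal play: \<open>wins_first_left G\<close> says that Left, moving first in \<open>G\<close>, can force
  a win. A player wins moving second iff the opponent does not win moving first.
\<close>

function wins_first_left :: "game \<Rightarrow> bool" and wins_first_right :: "game \<Rightarrow> bool" where
  "wins_first_left G \<longleftrightarrow> fBex (left_opts G) (\<lambda>G'. \<not> wins_first_right G')"
| "wins_first_right G \<longleftrightarrow> fBex (right_opts G) (\<lambda>G'. \<not> wins_first_left G')"
  by pat_completeness auto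
termination
  by (relation "measure (\<lambda>x. case x of Inl G \<Rightarrow> birthday G | Inr G \<Rightarrow> birthday G)")
     (auto simp: birthday_left_option_less birthday_right_option_less)

declare wins_first_left.simps [simp del] wins_first_right.simps [simp del]

datatype outcome_class = Left_Wins | Right_Wins | Next_Wins | Previous_Wins

definition outcome :: "game \<Rightarrow> outcome_class" where
  "outcome G =
     (if wins_first_left G
      then (if wins_first_right G then Next_Wins else Left_Wins)
      else (if wins_first_right G then Right_Wins else Previous_Wins))"

function nimber :: "nat \<Rightarrow> game" where
  "nimber m = Game (nimber |`| fset_of_list [0..<m]) (nimber |`| fset_of_list [0..<m])"
  by pat_completeness auto
termination
  by (relation "measure id") (auto simp: fset_of_list_elem)

declare nimber.simps [simp del]

definition up :: game where
  "up = Game {|0|} {|nimber 1|}"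

definition down :: game where
  "down = - up"

primrec copies :: "nat \<Rightarrow> game \<Rightarrow> game" where
  "copies 0 G = 0"
| "copies (Suc k) G = G + copies k G"

definition up_multiple :: "int \<Rightarrow> game" where
  "up_multiple w = (if w \<ge> 0 then copies (nat w) up else copies (nat \<bar>w\<bar>) down)"

text \<open>
  Far star is not a single game: in a sum it stands for any nimber \<open>nimber m\<close> whose
  birthday (which is \<open>m\<close>) exceeds that of the game it is added to. We therefore
  quantify over all such \<open>m\<close>.
\<close>

definition far_star_equiv :: "game \<Rightarrow> game \<Rightarrow> bool" where
  "far_star_equiv G H \<longleftrightarrow>
     (\<forall>X m. birthday (G + X) < m \<and> birthday (H + X) < m \<longrightarrow>
        outcome (G + X + nimber m) = outcome (H + X + nimber m))"

text \<open>
  A relation rather than a function, since a game need not have an atomic weight: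
  \<open>has_atomic_weight G w\<close> asserts that \<open>G\<close> is atomic, with weight \<open>w\<close>.
\<close>

definition has_atomic_weight :: "game \<Rightarrow> int \<Rightarrow> bool" where
  "has_atomic_weight G w \<longleftrightarrow> far_star_equiv G (up_multiple w)"

text \<open>
  \<open>truncated_support \<tau> n a b\<close> is the game \<open>\<T>\<^sub>\<tau>(n; a, b)\<close>.
\<close>

function truncated_support :: "nat \<Rightarrow> nat \<Rightarrow> nat \<Rightarrow> nat \<Rightarrow> game" where
  "truncated_support \<tau> n a b =
     Game ((\<lambda>i. truncated_support \<tau> (n - i) a b) |`|
             fset_of_list (filter (\<lambda>i. i \<le> n) [1..<Suc a]))
          ((\<lambda>j. truncated_support \<tau> (n - j) a b) |`|
             fset_of_list (filter (\<lambda>j. j \<le> n) [\<tau> + 1..<Suc b]))"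
  by pat_completeness auto
termination
  by (relation "measure (\<lambda>(\<tau>, n, a, b). n)") (auto simp: fset_of_list_elem)

declare truncated_support.simps [simp del]

end

theory Submission
  imports Defs
begin

text \<open>
  The proof plays the game. Write \<open>T n\<close> for the heap of size \<open>n\<close>, and \<open>p\<close> for the claimed
  value of \<open>- aw (T n)\<close>, so that \<open>n = a + \<tau> + 1 + p a + r\<close> with \<open>0 \<le> r < a\<close>.

  A far-star comparison can be tested without quantifying over \<open>X\<close>: \<open>G\<close> and \<open>H\<close> are
  equivalent as soon as Left, moving second, wins both \<open>G - H + \<up> + \<star>\<close> and
  \<open>H - G + \<up> + \<star>\<close> for a sufficiently large nimber \<open>\<star>\<close> (\<open>far_star_equivI\<close>). For
  \<open>H = p \<cdot> \<down>\<close> it therefore suffices that Right, moving first, loses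
  \<open>T n + (p + 1) \<cdot> \<up> + \<star>\<close>, and that Left, moving first, loses
  \<open>T n + p \<cdot> \<up> + \<down> + \<star>\<close>, which for \<open>p \<ge> 1\<close> is \<open>T n + (p - 1) \<cdot> \<up> + \<star>\<close>.

  Both are instances of strategies for all positions \<open>T n + q \<cdot> \<up> + *k\<close>. A heap with
  \<open>1 \<le> n \<le> \<tau>\<close> leaves Right without a move and counts as \<open>n\<close> free moves for Left. A heap
  with \<open>\<tau> < n \<le> a + \<tau>\<close> is hot: Left can move to one of those winning heaps, while Right can
  empty the heap at once. In larger heaps Left's best move is to remove \<open>a\<close> pebbles. Doing this
  repeatedly she arrives at a hot heap with Right to move, and Right must answer by emptying it.
  So each \<open>a\<close> pebbles beyond \<open>a + \<tau> + 1\<close> play like one \<open>\<down>\<close>. Left wins if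
  she has enough copies of \<open>\<up>\<close> to make up for this (\<open>left_wins_position\<close>); if there
  are few enough of them, Right wins (\<open>right_wins_position\<close>), who never needs the heap except for replying to a hot heap or when nothing but the heap is left. In the latter
  case he empties the heap if it has at most \<open>b\<close> pebbles; if it has more, he removes
  \<open>\<tau> + 1\<close>, and as \<open>b > a + 2 \<tau>\<close>, more than \<open>a + \<tau>\<close> pebbles remain.
\<close>

section \<open>Sums and negatives of games\<close>

lemma left_opts_plus:
  "left_opts (G + H) = (\<lambda>G'. G' + H) |`| left_opts G |\<union>| (\<lambda>H'. G + H') |`| left_opts H"
  by (subst plus_game.simps) simp

lemma right_opts_plus:
  "right_opts (G + H) = (\<lambda>G'. G' + H) |`| right_opts G |\<union>| (\<lambda>H'. G + H') |`| right_opts H"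
  by (subst plus_game.simps) simp

lemma left_opts_plus_iff:
  "K |\<in>| left_opts (G + H) \<longleftrightarrow>
     (\<exists>G'. G' |\<in>| left_opts G \<and> K = G' + H) \<or> (\<exists>H'. H' |\<in>| left_opts H \<and> K = G + H')"
  by (auto simp: left_opts_plus)

lemma right_opts_plus_iff:
  "K |\<in>| right_opts (G + H) \<longleftrightarrow>
     (\<exists>G'. G' |\<in>| right_opts G \<and> K = G' + H) \<or> (\<exists>H'. H' |\<in>| right_opts H \<and> K = G + H')"
  by (auto simp: right_opts_plus)

lemma left_opts_zero [simp]: "left_opts 0 = {||}"
  and right_opts_zero [simp]: "right_opts 0 = {||}"
  by (simp_all add: zero_game_def)

lemma left_opts_uminus [simp]: "left_opts (- G) = uminus |`| right_opts G"
  by (cases G) simp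

lemma right_opts_uminus [simp]: "right_opts (- G) = uminus |`| left_opts G"
  by (cases G) simp

lemma game_birthday_induct [case_names options]:
  assumes "\<And>G. \<lbrakk>\<And>H. H |\<in>| left_opts G \<Longrightarrow> P H; \<And>H. H |\<in>| right_opts G \<Longrightarrow> P H\<rbrakk> \<Longrightarrow> P G"
  shows "P G"
proof (induction "birthday G" arbitrary: G rule: less_induct)
  case less
  then show ?case
    using assms birthday_left_option_less birthday_right_option_less by metis
qed

lemma game_add_commute: "G + H = H + (G :: game)"
proof (induction "birthday G + birthday H" arbitrary: G H rule: less_induct)
  case less
  have "(\<lambda>G'. G' + H) |`| left_opts G = (+) H |`| left_opts G"
    "(\<lambda>G'. G' + H) |`| right_opts G = (+) H |`| right_opts G"
    "(+) G |`| left_opts H = (\<lambda>H'. H' + G) |`| left_opts H"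
    "(+) G |`| right_opts H = (\<lambda>H'. H' + G) |`| right_opts H"
    using less birthday_left_option_less birthday_right_option_less
    by (auto intro!: fimage_cong)
  then show ?case
    by (intro game.expand conjI) (simp_all add: left_opts_plus right_opts_plus sup_commute)
qed

lemma game_add_0: "0 + G = (G :: game)"
proof (induction G rule: game_birthday_induct)
  case (options G)
  then have "(\<lambda>H'. 0 + H') |`| left_opts G = left_opts G"
    "(\<lambda>H'. 0 + H') |`| right_opts G = right_opts G"
    by (simp_all cong: fimage_cong)
  then show ?case
    by (intro game.expand conjI) (simp_all add: left_opts_plus right_opts_plus)
qed

lemma game_add_assoc: "(G + H) + K = G + (H + (K :: game))"
proof (induction "birthday G + birthday H + birthday K" arbitrary: G H K rule: less_induct)
  case less
  have 1: "(G' + H) + K = G' + (H + K)" if "G' |\<in>| left_opts G \<or> G' |\<in>| right_opts G" for G'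
    using that less birthday_left_option_less birthday_right_option_less by auto
  have 2: "(G + H') + K = G + (H' + K)" if "H' |\<in>| left_opts H \<or> H' |\<in>| right_opts H" for H'
    using that less birthday_left_option_less birthday_right_option_less by auto
  have 3: "(G + H) + K' = G + (H + K')" if "K' |\<in>| left_opts K \<or> K' |\<in>| right_opts K" for K'
    using that less birthday_left_option_less birthday_right_option_less by auto
  show ?case
    by (intro game.expand conjI)
       (simp_all add: left_opts_plus right_opts_plus fimage_funion fset.map_comp 1 2 3
         sup_assoc cong: fimage_cong)
qed

instance game :: comm_monoid_add
  by standard (rule game_add_assoc game_add_commute game_add_0)+

lemma game_minus_minus [simp]: "- (- G) = (G :: game)"
proof (induction G rule: game_birthday_induct)
  case (options G)
  then show ?case
    by (intro game.expand conjI) (simp_all add: fset.map_comp cong: fimage_cong)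
qed

lemma game_minus_zero [simp]: "- 0 = (0 :: game)"
  by (simp add: zero_game_def)

lemma game_minus_add [simp]: "- (G + H) = - G + - (H :: game)"
proof (induction "birthday G + birthday H" arbitrary: G H rule: less_induct)
  case less
  have 1: "- (G' + H) = - G' + - H" if "G' |\<in>| left_opts G \<or> G' |\<in>| right_opts G" for G'
    using that less birthday_left_option_less birthday_right_option_less by auto
  have 2: "- (G + H') = - G + - H'" if "H' |\<in>| left_opts H \<or> H' |\<in>| right_opts H" for H'
    using that less birthday_left_option_less birthday_right_option_less by auto
  show ?case
    by (intro game.expand conjI)
       (simp_all add: left_opts_plus right_opts_plus fimage_funion fset.map_comp 1 2
         cong: fimage_cong)
qed

lemma birthday_uminus [simp]: "birthday (- G) = birthday G"
proof (induction G rule: game_birthday_induct)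
  case (options G)
  then show ?case
    by (cases G) (simp add: fset.map_comp sup_commute cong: fimage_cong)
qed

lemma copies_uminus [simp]: "- copies k G = copies k (- G)"
  by (induction k) auto

section \<open>Winning sums\<close>

lemma wins_first_left_plus:
  "wins_first_left (G + H) \<longleftrightarrow>
     (\<exists>G'. G' |\<in>| left_opts G \<and> \<not> wins_first_right (G' + H)) \<or>
     (\<exists>H'. H' |\<in>| left_opts H \<and> \<not> wins_first_right (G + H'))"
  by (subst wins_first_left.simps) (auto simp: left_opts_plus)

lemma wins_first_right_plus:
  "wins_first_right (G + H) \<longleftrightarrow>
     (\<exists>G'. G' |\<in>| right_opts G \<and> \<not> wins_first_left (G' + H)) \<or>
     (\<exists>H'. H' |\<in>| right_opts H \<and> \<not> wins_first_left (G + H'))"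
  by (subst wins_first_right.simps) (auto simp: right_opts_plus)

lemma wins_first_uminus:
  "wins_first_left (- G) = wins_first_right G \<and> wins_first_right (- G) = wins_first_left G"
proof (induction G rule: game_birthday_induct)
  case (options G)
  have "wins_first_left (- G) \<longleftrightarrow> wins_first_right G"
    using options unfolding wins_first_left.simps[of "- G"] wins_first_right.simps[of G]
    by simp
  moreover have "wins_first_right (- G) \<longleftrightarrow> wins_first_left G"
    using options unfolding wins_first_right.simps[of "- G"] wins_first_left.simps[of G]
    by simp
  ultimately show ?case
    by blast
qed

lemmas wins_first_left_uminus [simp] = wins_first_uminus [THEN conjunct1]
  and wins_first_right_uminus [simp] = wins_first_uminus [THEN conjunct2]

lemma not_wins_first_zero [simp]: "\<not> wins_first_left 0" "\<not> wins_first_right 0"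
  by (simp_all add: wins_first_left.simps[of 0] wins_first_right.simps[of 0])

text \<open>
  The second player's winning strategies combine by answering in the component just played in.
  Both claims need each other: after a move of the opponent in one component, it is the player's
  turn there.
\<close>

lemma win_sum:
  "(\<not> wins_first_right G \<longrightarrow> \<not> wins_first_right H \<longrightarrow> \<not> wins_first_right (G + H)) \<and>
   (wins_first_left G \<longrightarrow> \<not> wins_first_right H \<longrightarrow> wins_first_left (G + H))"
proof (induction "birthday G + birthday H" arbitrary: G H rule: less_induct)
  case less
  have IH1: "\<not> wins_first_right (G' + H)"
    if "G' |\<in>| left_opts G" "\<not> wins_first_right G'" "\<not> wins_first_right H" for G'
    using that less birthday_left_option_less by auto
  have IH2: "wins_first_left (G' + H)"
    if "G' |\<in>| right_opts G" "wins_first_left G'" "\<not> wins_first_right H" for G'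
    using that less birthday_right_option_less by auto
  have IH3: "wins_first_left (G + H')"
    if "H' |\<in>| right_opts H" "wins_first_left H'" "\<not> wins_first_right G" for H'
    using that less(1)[of H' G] birthday_right_option_less[of H' H] by (auto simp: add.commute)
  have "\<not> wins_first_right (G + H)" if "\<not> wins_first_right G" "\<not> wins_first_right H"
    using that IH2 IH3 wins_first_right.simps[of G] wins_first_right.simps[of H]
    by (auto simp: wins_first_right_plus)
  moreover have "wins_first_left (G + H)" if "wins_first_left G" "\<not> wins_first_right H"
    using that IH1 wins_first_left.simps[of G] by (auto simp: wins_first_left_plus)
  ultimately show ?case
    by blast
qed

lemma not_wins_first_right_plus:
  "\<not> wins_first_right G \<Longrightarrow> \<not> wins_first_right H \<Longrightarrow> \<not> wins_first_right (G + H)"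
  and wins_first_left_plusI:
  "wins_first_left G \<Longrightarrow> \<not> wins_first_right H \<Longrightarrow> wins_first_left (G + H)"
  using win_sum by blast+

lemma not_wins_first_left_plus:
  "\<not> wins_first_left G \<Longrightarrow> \<not> wins_first_left H \<Longrightarrow> \<not> wins_first_left (G + H)"
  and wins_first_right_plusI:
  "wins_first_right G \<Longrightarrow> \<not> wins_first_left H \<Longrightarrow> wins_first_right (G + H)"
  using win_sum[of "- G" "- H"] wins_first_uminus[of "G + H"] by (simp_all)

definition second_wins :: "game \<Rightarrow> bool" where
  "second_wins G \<longleftrightarrow> \<not> wins_first_left G \<and> \<not> wins_first_right G"

lemma second_wins_plus: "second_wins G \<Longrightarrow> second_wins H \<Longrightarrow> second_wins (G + H)"
  by (simp add: second_wins_def not_wins_first_right_plus not_wins_first_left_plus)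

text \<open>
  The Tweedledum--Tweedledee strategy: every move is mirrored in the other component.
\<close>

lemma second_wins_minus: "second_wins (G + - G)"
proof (induction G rule: game_birthday_induct)
  case (options G)
  have "wins_first_right (G' + - G)" "wins_first_left (G + - G')" if "G' |\<in>| left_opts G" for G'
    using that options(1)[OF that]
    unfolding second_wins_def wins_first_right_plus[of G' "- G"] wins_first_left_plus[of G "- G'"]
    by auto
  moreover have "wins_first_left (G' + - G)" "wins_first_right (G + - G')"
    if "G' |\<in>| right_opts G" for G'
    using that options(2)[OF that]
    unfolding second_wins_def wins_first_left_plus[of G' "- G"] wins_first_right_plus[of G "- G'"]
    by auto
  ultimately show ?case
    unfolding second_wins_def wins_first_left_plus[of G "- G"] wins_first_right_plus[of G "- G"]
    by auto
qed

text \<open>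
  A component that the second player wins can be cancelled. Equality of game values enters
  only through this cancellation.
\<close>

lemma plus_second_wins:
  assumes "second_wins Z"
  shows "wins_first_left (G + Z) = wins_first_left G" "wins_first_right (G + Z) = wins_first_right G"
  using assms unfolding second_wins_def
  by (metis not_wins_first_left_plus wins_first_left_plusI,
      metis not_wins_first_right_plus wins_first_right_plusI)

section \<open>Nim addition\<close>

lemma left_opts_nimber: "G |\<in>| left_opts (nimber m) \<longleftrightarrow> (\<exists>k<m. G = nimber k)"
  by (subst nimber.simps) (auto simp: fset_of_list_elem)

lemma right_opts_nimber: "G |\<in>| right_opts (nimber m) \<longleftrightarrow> (\<exists>k<m. G = nimber k)"
  by (subst nimber.simps) (auto simp: fset_of_list_elem)

lemma nimber_0 [simp]: "nimber 0 = 0"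
  by (subst nimber.simps) (simp add: zero_game_def)

lemma nimber_uminus [simp]: "- nimber m = nimber m"
proof (induction m rule: less_induct)
  case (less m)
  then have "uminus |`| nimber |`| fset_of_list [0..<m] = nimber |`| fset_of_list [0..<m]"
    by (auto simp: fset.map_comp fset_of_list_elem intro!: fimage_cong)
  then show ?case
    by (subst (1 2) nimber.simps) simp
qed

lemma second_wins_nimber_double: "second_wins (nimber m + nimber m)"
  using second_wins_minus[of "nimber m"] by simp

lemma wins_first_left_nimber_plus:
  "wins_first_left (G + nimber m) \<longleftrightarrow>
     (\<exists>G'. G' |\<in>| left_opts G \<and> \<not> wins_first_right (G' + nimber m)) \<or>
     (\<exists>k<m. \<not> wins_first_right (G + nimber k))"
  by (subst wins_first_left_plus) (auto simp: left_opts_nimber)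

lemma wins_first_right_nimber_plus:
  "wins_first_right (G + nimber m) \<longleftrightarrow>
     (\<exists>G'. G' |\<in>| right_opts G \<and> \<not> wins_first_left (G' + nimber m)) \<or>
     (\<exists>k<m. \<not> wins_first_left (G + nimber k))"
  by (subst wins_first_right_plus) (auto simp: right_opts_nimber)

text \<open>
  Nim addition is obtained from the games themselves rather than from binary digits: the sum of
  \<open>*i\<close> and \<open>*j\<close> is the \<open>*k\<close> that balances them. All that matters below is that there is
  exactly one such \<open>k\<close> and that \<open>i\<close>, \<open>j\<close>, \<open>k\<close> satisfy the triangle inequalities.
\<close>

definition nim_balanced :: "nat \<Rightarrow> nat \<Rightarrow> nat \<Rightarrow> bool" where
  "nim_balanced i j k \<longleftrightarrow> second_wins (nimber i + nimber j + nimber k)"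

lemma nim_balanced_iff: "nim_balanced i j k \<longleftrightarrow> \<not> wins_first_left (nimber i + nimber j + nimber k)"
  using wins_first_left_uminus[of "nimber i + nimber j + nimber k"]
  by (simp add: nim_balanced_def second_wins_def)

lemma nim_balanced_commute:
  "nim_balanced i j k = nim_balanced j i k" "nim_balanced i j k = nim_balanced i k j"
  by (simp_all add: nim_balanced_def ac_simps)

lemma nim_balanced_unique: "nim_balanced i j k \<Longrightarrow> nim_balanced i j l \<Longrightarrow> k = l"
proof (induction k l rule: linorder_wlog)
  case (le k l)
  then show ?case
    using wins_first_left_nimber_plus[of "nimber i + nimber j" l]
    by (auto simp: nim_balanced_def second_wins_def le_less)
qed auto

lemma nim_balanced_by_moves:
  "nim_balanced i j k \<longleftrightarrow>
     (\<forall>i'<i. \<not> nim_balanced i' j k) \<and> (\<forall>j'<j. \<not> nim_balanced i j' k) \<and>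
     (\<forall>k'<k. \<not> nim_balanced i j k')"
proof -
  have *: "\<not> wins_first_right (nimber i + nimber j + nimber k) \<longleftrightarrow> nim_balanced i j k" for i j k
    using wins_first_left_uminus[of "nimber i + nimber j + nimber k"] by (simp add: nim_balanced_iff)
  have "wins_first_left (nimber i + nimber j + nimber k) \<longleftrightarrow>
     (\<exists>i'<i. nim_balanced i' j k) \<or> (\<exists>j'<j. nim_balanced i j' k) \<or> (\<exists>k'<k. nim_balanced i j k')"
    unfolding *[symmetric]
    unfolding wins_first_left_nimber_plus[of "nimber i + nimber j"] left_opts_plus_iff left_opts_nimber
    by blast
  then show ?thesis
    by (auto simp: nim_balanced_iff)
qed

text \<open>
  A minimal excluded value argument. The values ruled out for \<open>k\<close> are those that balance a
  position reached by a move in \<open>*i\<close> or in \<open>*j\<close>. There are at most \<open>i + j\<close> of them, as each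
  such position is balanced by at most one nimber.
\<close>

lemma nim_balanced_exists: "\<exists>k\<le>i + j. nim_balanced i j k"
proof -
  define E where "E = {k. \<exists>i'<i. nim_balanced i' j k} \<union> {k. \<exists>j'<j. nim_balanced i j' k}"
  let ?f = "\<lambda>i'. THE k. nim_balanced i' j k" and ?g = "\<lambda>j'. THE k. nim_balanced i j' k"
  have "E \<subseteq> ?f ` {..<i} \<union> ?g ` {..<j}"
    unfolding E_def by (auto simp: image_iff intro!: bexI the_equality[symmetric] intro: nim_balanced_unique)
  then have "card E \<le> card (?f ` {..<i} \<union> ?g ` {..<j})"
    by (intro card_mono) auto
  also have "\<dots> \<le> card (?f ` {..<i}) + card (?g ` {..<j})"
    by (rule card_Un_le)
  also have "\<dots> \<le> i + j"
    using card_image_le[of "{..<i}" ?f] card_image_le[of "{..<j}" ?g] by simp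
  finally have "card E < card {..i + j}"
    by simp
  moreover have "finite E"
    using \<open>E \<subseteq> _\<close> by (rule finite_subset) auto
  ultimately have "\<not> {..i + j} \<subseteq> E"
    using card_mono by (metis not_less)
  then obtain k0 where k0: "k0 \<notin> E" "k0 \<le> i + j"
    by auto
  define k where "k = (LEAST k. k \<notin> E)"
  have "k \<notin> E" "k \<le> k0" "\<And>k'. k' < k \<Longrightarrow> k' \<in> E"
    unfolding k_def using k0 LeastI[of "\<lambda>k. k \<notin> E"] Least_le[of "\<lambda>k. k \<notin> E"]
    by (auto dest: not_less_Least)
  moreover have "\<not> nim_balanced i j k'" if "k' \<in> E" for k'
    using that unfolding E_def nim_balanced_by_moves[of i j k'] by blast
  ultimately have "nim_balanced i j k"
    unfolding nim_balanced_by_moves[of i j k] by (auto simp: E_def)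
  then show ?thesis
    using \<open>k0 \<le> i + j\<close> \<open>k \<le> k0\<close> le_trans by blast
qed

definition nim_sum :: "nat \<Rightarrow> nat \<Rightarrow> nat" where
  "nim_sum i j = (THE k. nim_balanced i j k)"

lemma nim_sum_eq_iff: "nim_sum i j = k \<longleftrightarrow> nim_balanced i j k"
  unfolding nim_sum_def
  by (metis nim_balanced_exists nim_balanced_unique the_equality)

lemma nim_sum_le: "nim_sum i j \<le> i + j"
  using nim_balanced_exists nim_sum_eq_iff by metis

lemma nim_sum_commute: "nim_sum i j = nim_sum j i"
  using nim_sum_eq_iff nim_balanced_commute by metis

lemma nim_sum_triangle: "i \<le> j + nim_sum i j"
  using nim_sum_le[of j "nim_sum i j"] nim_sum_eq_iff nim_balanced_commute by metis

lemma second_wins_nim_sum: "second_wins (nimber i + nimber j + nimber (nim_sum i j))"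
  using nim_sum_eq_iff nim_balanced_def by metis

lemma plus_nimber_nimber:
  "wins_first_left (G + nimber i + nimber j) = wins_first_left (G + nimber (nim_sum i j))"
  "wins_first_right (G + nimber i + nimber j) = wins_first_right (G + nimber (nim_sum i j))"
proof -
  let ?s = "nimber (nim_sum i j)"
  have eq: "G + nimber i + nimber j + (?s + ?s) = G + ?s + (nimber i + nimber j + ?s)"
    by (simp add: ac_simps)
  show "wins_first_left (G + nimber i + nimber j) = wins_first_left (G + ?s)"
    "wins_first_right (G + nimber i + nimber j) = wins_first_right (G + ?s)"
    using arg_cong[OF eq, of wins_first_left] arg_cong[OF eq, of wins_first_right]
    by (simp_all only: plus_second_wins second_wins_nimber_double second_wins_nim_sum)
qed

lemma nim_sum_1_ge_2: "2 \<le> k \<Longrightarrow> 2 \<le> nim_sum 1 k"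
proof (rule ccontr)
  assume k: "2 \<le> k" and "\<not> 2 \<le> nim_sum 1 k"
  moreover have "nim_sum 1 k \<noteq> 0"
    using nim_sum_triangle[of k 1] k nim_sum_eq_iff nim_balanced_commute(1)
    by (metis add.right_neutral not_less_eq_eq numeral_2_eq_2 One_nat_def)
  ultimately have "nim_balanced 1 1 k"
    using nim_sum_eq_iff[of 1 k 1] nim_balanced_commute(2)[of 1 k 1] by auto
  moreover have "nim_balanced 1 1 0"
    using second_wins_nimber_double[of 1] by (simp add: nim_balanced_def)
  ultimately show False
    using nim_balanced_unique k by fastforce
qed

section \<open>Outcomes under far star\<close>

text \<open>
  Far star is well defined: all nimbers larger than the birthday of \<open>Y\<close> give the same outcome.
  The critical case is that Left's winning move in \<open>Y + *m'\<close> is to \<open>Y + *k\<close> with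
  \<open>k \<ge> m\<close>, which is not available in \<open>Y + *m\<close>. Then Right loses moving from \<open>*k\<close> to
  any smaller nimber. For \<open>k > m\<close> this includes \<open>*m\<close>, and for \<open>k = m\<close> it includes
  \<open>*(m - 1)\<close>, where Left's winning move also works next to \<open>*m\<close>: if it is in \<open>Y\<close>,
  then because \<open>m - 1\<close> still exceeds the birthday of the option.
\<close>

lemma wins_first_left_far_star_le:
  assumes "birthday Y < m" "m \<le> m'"
  shows "wins_first_left (Y + nimber m) = wins_first_left (Y + nimber m')"
  using assms
proof (induction "birthday Y" arbitrary: Y m m' rule: less_induct)
  case less
  have *: "wins_first_right (Z + nimber k) = wins_first_right (Z + nimber k')"
    if "birthday Z < birthday Y" "birthday Z < k" "k \<le> k'" for Z k k'
    using that less.hyps[of "- Z" k k'] wins_first_left_uminus[of "Z + nimber k"]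
      wins_first_left_uminus[of "Z + nimber k'"]
    by simp
  have option_stable: "wins_first_right (Z + nimber k) = wins_first_right (Z + nimber k')"
    if "Z |\<in>| left_opts Y" "birthday Y \<le> k" "k \<le> k'" for Z k k'
    using * that birthday_left_option_less[OF that(1)] by simp
  show ?case
  proof
    assume "wins_first_left (Y + nimber m)"
    then show "wins_first_left (Y + nimber m')"
      unfolding wins_first_left_nimber_plus[of Y] using option_stable less.prems
      by (meson less_imp_le less_le_trans)
  next
    assume "wins_first_left (Y + nimber m')"
    then consider (opt) Z where "Z |\<in>| left_opts Y" "\<not> wins_first_right (Z + nimber m')"
      | (nim) k where "k < m'" "\<not> wins_first_right (Y + nimber k)"
      unfolding wins_first_left_nimber_plus[of Y] by blast
    then show "wins_first_left (Y + nimber m)"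
    proof cases
      case opt
      then show ?thesis
        unfolding wins_first_left_nimber_plus[of Y] using option_stable less.prems
        by (meson less_imp_le less_le_trans)
    next
      case nim
      consider "k < m" | "k = m" | "m < k"
        by linarith
      then show ?thesis
      proof cases
        case 1
        then show ?thesis
          unfolding wins_first_left_nimber_plus[of Y] using nim by blast
      next
        case 2
        obtain m0 where m0: "m = Suc m0"
          using less.prems by (cases m) auto
        with 2 nim have "wins_first_left (Y + nimber m0)"
          unfolding wins_first_right_nimber_plus[of Y] by blast
        then show ?thesis
          unfolding wins_first_left_nimber_plus[of Y] using option_stable[of _ m0 m] less.prems m0
          by (metis less_Suc_eq less_Suc_eq_le less_imp_le)
      next
        case 3
        then show ?thesis
          using nim unfolding wins_first_right_nimber_plus[of Y] by blast
      qed
    qed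
  qed
qed

text \<open>
  The smallest nimber that counts as far star for \<open>Y\<close> stands for all of them, as they give the
  same outcome.
\<close>

definition left_first_far :: "game \<Rightarrow> bool" where
  "left_first_far Y \<longleftrightarrow> wins_first_left (Y + nimber (Suc (birthday Y)))"

definition left_second_far :: "game \<Rightarrow> bool" where
  "left_second_far Y \<longleftrightarrow> \<not> wins_first_right (Y + nimber (Suc (birthday Y)))"

lemma wins_first_left_far_star:
  "birthday Y < m \<Longrightarrow> wins_first_left (Y + nimber m) \<longleftrightarrow> left_first_far Y"
  unfolding left_first_far_def
  using wins_first_left_far_star_le[of Y "Suc (birthday Y)" m] by simp

lemma left_first_far_uminus: "left_first_far (- Y) \<longleftrightarrow> \<not> left_second_far Y"
  using wins_first_left_uminus[of "Y + nimber (Suc (birthday Y))"]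
  by (simp add: left_first_far_def left_second_far_def)

lemma left_second_far_uminus: "left_second_far (- Y) \<longleftrightarrow> \<not> left_first_far Y"
  using left_first_far_uminus[of "- Y"] by simp

lemma wins_first_right_far_star:
  assumes "birthday Y < m"
  shows "wins_first_right (Y + nimber m) \<longleftrightarrow> \<not> left_second_far Y"
  using assms wins_first_left_far_star[of "- Y" m] wins_first_left_uminus[of "Y + nimber m"]
  by (simp add: left_first_far_uminus)

text \<open>
  By moving from a far star to a smaller far star Left can pass the turn.
\<close>

lemma left_second_far_imp_first: "left_second_far Y \<Longrightarrow> left_first_far Y"
proof -
  assume "left_second_far Y"
  then have "wins_first_left (Y + nimber (Suc (Suc (birthday Y))))"
    unfolding wins_first_left_nimber_plus[of Y] left_second_far_def by blast
  then show ?thesis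
    by (simp add: wins_first_left_far_star)
qed

lemma far_cong:
  assumes "\<And>m. wins_first_left (Y + nimber m) = wins_first_left (Z + nimber m)"
    and "\<And>m. wins_first_right (Y + nimber m) = wins_first_right (Z + nimber m)"
  shows "left_first_far Y = left_first_far Z" "left_second_far Y = left_second_far Z"
proof -
  define M where "M = Suc (birthday Y + birthday Z)"
  have "birthday Y < M" "birthday Z < M"
    by (simp_all add: M_def)
  then show "left_first_far Y = left_first_far Z" "left_second_far Y = left_second_far Z"
    using assms[of M] by (simp_all add: wins_first_left_far_star wins_first_right_far_star)
qed

lemma far_plus_second_wins:
  assumes "second_wins Z"
  shows "left_first_far (Y + Z) = left_first_far Y" "left_second_far (Y + Z) = left_second_far Y"
proof -
  have "Y + Z + nimber m = Y + nimber m + Z" for m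
    by (simp add: ac_simps)
  then show "left_first_far (Y + Z) = left_first_far Y" "left_second_far (Y + Z) = left_second_far Y"
    using far_cong[of "Y + Z" Y] by (simp_all add: plus_second_wins assms)
qed

text \<open>
  Far star for \<open>Y\<close> is also far for the options of \<open>Y\<close>, so the recursion for outcomes carries
  over; apart from moves in \<open>Y\<close> it has to account for the moves from far star to \<open>*k\<close> with \<open>k\<close>
  at most the birthday of \<open>Y\<close>.
\<close>

lemma left_second_far_option:
  "left_second_far Y \<Longrightarrow> Y' |\<in>| right_opts Y \<Longrightarrow> left_first_far Y'"
  using wins_first_right_nimber_plus[of Y "Suc (birthday Y)"] birthday_right_option_less[of Y' Y]
  by (auto simp: left_second_far_def wins_first_left_far_star)

lemma left_first_farI:
  assumes "Y' |\<in>| left_opts Y" "left_second_far Y'"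
  shows "left_first_far Y"
proof -
  have "\<not> wins_first_right (Y' + nimber (Suc (birthday Y)))"
    using assms birthday_left_option_less[of Y' Y] by (simp add: wins_first_right_far_star)
  then show ?thesis
    unfolding left_first_far_def wins_first_left_nimber_plus[of Y] using assms by blast
qed

lemma left_second_farI:
  assumes "\<And>Y'. Y' |\<in>| right_opts Y \<Longrightarrow> left_first_far Y'"
    and "\<And>k. k \<le> birthday Y \<Longrightarrow> wins_first_left (Y + nimber k)"
  shows "left_second_far Y"
  unfolding left_second_far_def wins_first_right_nimber_plus[of Y]
  using assms birthday_right_option_less[of _ Y]
  by (metis less_Suc_eq less_Suc_eq_le wins_first_left_far_star)

lemma left_first_farE:
  assumes "left_first_far Y"
  obtains (opt) Y' where "Y' |\<in>| left_opts Y" "left_second_far Y'"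
    | (nim) k where "k \<le> birthday Y" "\<not> wins_first_right (Y + nimber k)"
  using assms birthday_left_option_less[of _ Y] less_SucI
  unfolding left_first_far_def wins_first_left_nimber_plus[of Y]
  by (metis less_Suc_eq_le wins_first_right_far_star)

lemma left_opts_up: "left_opts up = {|0|}" and right_opts_up: "right_opts up = {|nimber 1|}"
  by (simp_all add: up_def)

lemma left_opts_down: "left_opts down = {|nimber 1|}" and right_opts_down: "right_opts down = {|0|}"
  by (simp_all add: down_def left_opts_up right_opts_up)

lemma not_wins_first_right_up: "\<not> wins_first_right up"
  using wins_first_left_nimber_plus[of 0 1] by (auto simp: wins_first_right.simps[of up] right_opts_up)

lemma second_wins_up_down: "second_wins (up + down)"
  using second_wins_minus[of up] by (simp add: down_def)

text \<open>
  Moving from \<open>\<down>\<close> to \<open>*\<close> leaves a sum of nimbers, which \<open>*l\<close> has to balance. The bound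
  makes \<open>l\<close> a far star whenever \<open>m\<close> is much larger than \<open>k\<close>.
\<close>

lemma obtain_balancing_star:
  obtains l where "m \<le> 1 + k + l" "wins_first_left (down + nimber m + nimber k + nimber l)"
proof -
  define l where "l = nim_sum (nim_sum 1 k) m"
  have "\<not> wins_first_right (nimber 1 + nimber m + nimber k + nimber l)"
    using plus_nimber_nimber(2)[of "nimber m + nimber l" 1 k] second_wins_nim_sum[of "nim_sum 1 k" m]
    by (simp add: ac_simps second_wins_def l_def)
  then have "wins_first_left (down + nimber m + nimber k + nimber l)"
    using wins_first_left_plus[of down "nimber m + nimber k + nimber l"]
    by (auto simp: left_opts_down add.assoc)
  moreover have "m \<le> nim_sum 1 k + l"
    unfolding l_def nim_sum_commute[of _ m] by (rule nim_sum_triangle)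
  then have "m \<le> 1 + k + l"
    using nim_sum_le[of 1 k] by linarith
  ultimately show thesis
    using that by blast
qed

text \<open>
  Left's winning strategies in the three sums of the hypotheses add up to one in the sum of all,
  in which \<open>\<up> + \<down>\<close>, \<open>*i + *i\<close> and \<open>*j + *j\<close> cancel.
\<close>

lemma wins_first_left_plus_via_stars:
  assumes "\<not> wins_first_right (D + up + nimber i)" "\<not> wins_first_right (Y + nimber j)"
    and "wins_first_left (down + nimber i + nimber j + nimber k)"
  shows "wins_first_left (D + Y + nimber k)"
proof -
  let ?Z = "(up + down) + (nimber i + nimber i) + (nimber j + nimber j)"
  have "wins_first_left ((down + nimber i + nimber j + nimber k) + ((D + up + nimber i) + (Y + nimber j)))"
    by (intro wins_first_left_plusI not_wins_first_right_plus assms)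
  also have "(down + nimber i + nimber j + nimber k) + ((D + up + nimber i) + (Y + nimber j)) =
      (D + Y + nimber k) + ?Z"
    by (simp add: ac_simps)
  finally show ?thesis
    by (simp add: plus_second_wins second_wins_plus second_wins_up_down second_wins_nimber_double)
qed

text \<open>
  If Left, moving second, wins \<open>D + \<up>\<close> next to far star, then \<open>D\<close> can be added to \<open>Y\<close> without harming her.
  She answers every move in \<open>D\<close> or \<open>Y\<close> by her strategy for that component. Trouble arises only
  when someone moves in the single far star, since the hypotheses on \<open>D\<close> and \<open>Y\<close> each come with
  a far star of their own. All these cases are settled by \<open>wins_first_left_plus_via_stars\<close>:
  the stars are chosen so that, after Left has moved from \<open>\<down>\<close> to \<open>*\<close>, they balance, which
  is where the slack of one \<open>\<up>\<close> is used up.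
\<close>

lemma far_plus:
  "(left_second_far (D + up) \<longrightarrow> left_second_far Y \<longrightarrow> left_second_far (D + Y)) \<and>
   (left_second_far (D + up) \<longrightarrow> left_first_far Y \<longrightarrow> left_first_far (D + Y)) \<and>
   (left_first_far (D + up) \<longrightarrow> left_second_far Y \<longrightarrow> left_first_far (D + Y))"
proof (induction "birthday D + birthday Y" arbitrary: D Y rule: less_induct)
  case less
  define M where "M = birthday D + birthday Y + birthday (D + up) + birthday (D + Y) + 5"
  have second: "left_second_far (D + Y)" if D: "left_second_far (D + up)" and Y: "left_second_far Y"
  proof -
    have "left_first_far (D' + Y)" if "D' |\<in>| right_opts D" for D'
    proof -
      have "left_first_far (D' + up)"
        using left_second_far_option[OF D, of "D' + up"] that by (auto simp: right_opts_plus)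
      then show ?thesis
        using less[of D' Y] birthday_right_option_less[OF that] Y by simp
    qed
    moreover have "left_first_far (D + Y')" if "Y' |\<in>| right_opts Y" for Y'
      using less[of D Y'] birthday_right_option_less[OF that] left_second_far_option[OF Y that] D by simp
    moreover have "wins_first_left (D + Y + nimber k)" if "k \<le> birthday (D + Y)" for k
    proof -
      \<comment> \<open>Take \<open>*(M + M)\<close> as the star next to \<open>D + \<up>\<close>; the balancing star is then far for \<open>Y\<close>.\<close>
      obtain j where j: "M + M \<le> 1 + k + j"
        "wins_first_left (down + nimber (M + M) + nimber k + nimber j)"
        by (rule obtain_balancing_star)
      then have "birthday Y < j" "birthday (D + up) < M + M"
        using that by (auto simp: M_def)
      then have "\<not> wins_first_right (D + up + nimber (M + M))" "\<not> wins_first_right (Y + nimber j)"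
        using D Y by (simp_all add: wins_first_right_far_star)
      then show ?thesis
        by (rule wins_first_left_plus_via_stars) (use j(2) in \<open>simp add: ac_simps\<close>)
    qed
    ultimately show ?thesis
      by (intro left_second_farI) (auto simp: right_opts_plus)
  qed
  have first1: "left_first_far (D + Y)" if D: "left_second_far (D + up)" and Y: "left_first_far Y"
    using Y
  proof (cases rule: left_first_farE)
    case (opt Y')
    then have "left_second_far (D + Y')"
      using less[of D Y'] birthday_left_option_less[OF opt(1)] D by simp
    then show ?thesis
      using opt by (auto intro!: left_first_farI simp: left_opts_plus)
  next
    case (nim k)
    \<comment> \<open>Left's move to \<open>Y + *k\<close> fixes one star; \<open>*(M + M)\<close> is now the far star next to \<open>D + Y\<close>.\<close>
    obtain i where i: "M + M \<le> 1 + k + i"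
      "wins_first_left (down + nimber (M + M) + nimber k + nimber i)"
      by (rule obtain_balancing_star)
    then have "birthday (D + up) < i"
      using nim by (auto simp: M_def)
    then have "\<not> wins_first_right (D + up + nimber i)"
      using D by (simp add: wins_first_right_far_star)
    then have "wins_first_left (D + Y + nimber (M + M))"
      using nim(2) by (rule wins_first_left_plus_via_stars) (use i(2) in \<open>simp add: ac_simps\<close>)
    then show ?thesis
      by (simp add: wins_first_left_far_star M_def)
  qed
  have first2: "left_first_far (D + Y)" if D: "left_first_far (D + up)" and Y: "left_second_far Y"
    using D
  proof (cases rule: left_first_farE)
    case (opt E)
    then consider D' where "D' |\<in>| left_opts D" "E = D' + up" | "E = D"
      by (auto simp: left_opts_plus left_opts_up)
    then show ?thesis
    proof cases
      case 1
      then have "left_second_far (D' + Y)"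
        using less[of D' Y] birthday_left_option_less[of D' D] Y opt by simp
      then show ?thesis
        using 1 by (auto intro!: left_first_farI simp: left_opts_plus)
    next
      case 2
      then have "\<not> wins_first_right (D + nimber M)"
        using opt by (simp add: wins_first_right_far_star M_def)
      then have "\<not> wins_first_right (D + nimber M + up)"
        using not_wins_first_right_up by (rule not_wins_first_right_plus)
      then have "left_second_far (D + up)"
        using wins_first_right_far_star[of "D + up" M] by (simp add: M_def ac_simps)
      then show ?thesis
        using Y by (intro left_second_far_imp_first second)
    qed
  next
    case (nim k)
    obtain j where j: "M + M \<le> 1 + k + j"
      "wins_first_left (down + nimber (M + M) + nimber k + nimber j)"
      by (rule obtain_balancing_star)
    then have "birthday Y < j"
      using nim by (auto simp: M_def)
    then have "\<not> wins_first_right (Y + nimber j)"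
      using Y by (simp add: wins_first_right_far_star)
    with nim(2) have "wins_first_left (D + Y + nimber (M + M))"
      by (rule wins_first_left_plus_via_stars) (use j(2) in \<open>simp add: ac_simps\<close>)
    then show ?thesis
      by (simp add: wins_first_left_far_star M_def)
  qed
  show ?case
    using second first1 first2 by blast
qed

lemma far_mono:
  assumes "left_second_far (G + - H + up)"
  shows "left_first_far (H + X) \<Longrightarrow> left_first_far (G + X)" "left_second_far (H + X) \<Longrightarrow> left_second_far (G + X)"
proof -
  have eq: "G + - H + (H + X) = G + X + (H + - H)"
    by (simp add: ac_simps)
  show "left_first_far (H + X) \<Longrightarrow> left_first_far (G + X)" "left_second_far (H + X) \<Longrightarrow> left_second_far (G + X)"
    using far_plus[of "G + - H" "H + X"] assms unfolding eq
    by (simp_all add: far_plus_second_wins second_wins_minus)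
qed

text \<open>
  Adding \<open>G - H\<close> to \<open>H + X\<close> yields \<open>G + X\<close>, so \<open>far_plus\<close> transfers Left's wins from
  \<open>H + X\<close> to \<open>G + X\<close>; exchanging the roles of \<open>G\<close> and \<open>H\<close> gives the converse.
\<close>

lemma far_star_equivI:
  assumes "left_second_far (G + - H + up)" "left_second_far (H + - G + up)"
  shows "far_star_equiv G H"
  unfolding far_star_equiv_def
proof (intro allI impI)
  fix X m
  assume "birthday (G + X) < m \<and> birthday (H + X) < m"
  then show "outcome (G + X + nimber m) = outcome (H + X + nimber m)"
    using far_mono[OF assms(1), of X] far_mono[OF assms(2), of X]
    by (auto simp: outcome_def wins_first_left_far_star wins_first_right_far_star)
qed

section \<open>Truncated support with ups and a star\<close>

lemma left_opts_truncated_support: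
  "G |\<in>| left_opts (truncated_support \<tau> n a b) \<longleftrightarrow>
     (\<exists>n'<n. n \<le> n' + a \<and> G = truncated_support \<tau> n' a b)"
proof
  assume "G |\<in>| left_opts (truncated_support \<tau> n a b)"
  then obtain i where "1 \<le> i" "i \<le> a" "i \<le> n" "G = truncated_support \<tau> (n - i) a b"
    by (subst (asm) truncated_support.simps) (auto simp: fset_of_list_elem)
  then show "\<exists>n'<n. n \<le> n' + a \<and> G = truncated_support \<tau> n' a b"
    by (intro exI[of _ "n - i"]) auto
next
  assume "\<exists>n'<n. n \<le> n' + a \<and> G = truncated_support \<tau> n' a b"
  then obtain n' where "n' < n" "n \<le> n' + a" "G = truncated_support \<tau> n' a b"
    by blast
  then show "G |\<in>| left_opts (truncated_support \<tau> n a b)"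
    by (subst truncated_support.simps) (auto simp: fset_of_list_elem simp del: upt_Suc intro!: image_eqI[of _ _ "n - n'"])
qed

lemma right_opts_truncated_support:
  "G |\<in>| right_opts (truncated_support \<tau> n a b) \<longleftrightarrow>
     (\<exists>n'. n' + \<tau> + 1 \<le> n \<and> n \<le> n' + b \<and> G = truncated_support \<tau> n' a b)"
proof
  assume "G |\<in>| right_opts (truncated_support \<tau> n a b)"
  then obtain j where "\<tau> + 1 \<le> j" "j \<le> b" "j \<le> n" "G = truncated_support \<tau> (n - j) a b"
    by (subst (asm) truncated_support.simps) (auto simp: fset_of_list_elem)
  then show "\<exists>n'. n' + \<tau> + 1 \<le> n \<and> n \<le> n' + b \<and> G = truncated_support \<tau> n' a b"
    by (intro exI[of _ "n - j"]) auto
next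
  assume "\<exists>n'. n' + \<tau> + 1 \<le> n \<and> n \<le> n' + b \<and> G = truncated_support \<tau> n' a b"
  then obtain n' where "n' + \<tau> + 1 \<le> n" "n \<le> n' + b" "G = truncated_support \<tau> n' a b"
    by blast
  then show "G |\<in>| right_opts (truncated_support \<tau> n a b)"
    by (subst truncated_support.simps) (auto simp: fset_of_list_elem simp del: upt_Suc intro!: image_eqI[of _ _ "n - n'"])
qed

lemma truncated_support_empty_heap: "truncated_support \<tau> 0 a b = 0"
  by (intro game.expand conjI fset_eqI)
    (simp_all add: left_opts_truncated_support right_opts_truncated_support)

lemma left_opts_copies_up:
  "G |\<in>| left_opts (copies q up) \<longleftrightarrow> 0 < q \<and> G = copies (q - 1) up"
proof (induction q arbitrary: G)
  case (Suc q)
  show ?case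
    unfolding copies.simps left_opts_plus_iff left_opts_up Suc.IH
    by (cases q) (auto simp: add_0)
qed simp

lemma right_opts_copies_up:
  "G |\<in>| right_opts (copies q up) \<longleftrightarrow> 0 < q \<and> G = nimber 1 + copies (q - 1) up"
proof (induction q arbitrary: G)
  case (Suc q)
  show ?case
    unfolding copies.simps right_opts_plus_iff right_opts_up Suc.IH
    by (cases q) (auto simp: add.left_commute)
qed simp

lemma triple_induct [case_names less]:
  fixes P :: "nat \<Rightarrow> nat \<Rightarrow> nat \<Rightarrow> bool"
  assumes "\<And>n q k. (\<And>n' q' k'. n' < n \<or> n' = n \<and> (q' < q \<or> q' = q \<and> k' < k) \<Longrightarrow> P n' q' k') \<Longrightarrow> P n q k"
  shows "P n q k"
proof -
  have "wf (less_than <*lex*> less_than <*lex*> less_than)"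
    by auto
  then have "case x of (n, q, k) \<Rightarrow> P n q k" for x
  proof (induction x rule: wf_induct_rule)
    case (less x)
    obtain n q k where x: "x = (n, q, k)"
      by (cases x)
    have "P n q k"
    proof (rule assms)
      fix n' q' k'
      assume "n' < n \<or> n' = n \<and> (q' < q \<or> q' = q \<and> k' < k)"
      then show "P n' q' k'"
        using less[of "(n', q', k')"] by (auto simp: x)
    qed
    then show ?case
      by (simp add: x)
  qed
  from this[of "(n, q, k)"] show ?thesis
    by simp
qed

context
  fixes a b \<tau> :: nat
  assumes pos: "0 < a" "1 \<le> \<tau>"
    and gap: "a + 2 * \<tau> < b"
begin

definition position :: "nat \<Rightarrow> nat \<Rightarrow> nat \<Rightarrow> game" where
  "position n q k = truncated_support \<tau> n a b + copies q up + nimber k"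

lemma wins_first_left_position:
  "wins_first_left (position n q k) \<longleftrightarrow>
     (\<exists>n'<n. n \<le> n' + a \<and> \<not> wins_first_right (position n' q k)) \<or>
     (0 < q \<and> \<not> wins_first_right (position n (q - 1) k)) \<or>
     (\<exists>k'<k. \<not> wins_first_right (position n q k'))"
  unfolding position_def wins_first_left_nimber_plus[of "_ + _"] left_opts_plus_iff
    left_opts_truncated_support left_opts_copies_up
  by blast

text \<open>
  Right's move from \<open>\<up>\<close> to \<open>*\<close> alters the nimber, which is recorded by \<open>nim_sum 1 k\<close>.
\<close>

lemma wins_first_right_position:
  "wins_first_right (position n q k) \<longleftrightarrow>
     (\<exists>n'. n' + \<tau> + 1 \<le> n \<and> n \<le> n' + b \<and> \<not> wins_first_left (position n' q k)) \<or>
     (0 < q \<and> \<not> wins_first_left (position n (q - 1) (nim_sum 1 k))) \<or>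
     (\<exists>k'<k. \<not> wins_first_left (position n q k'))"
proof -
  have "wins_first_left (truncated_support \<tau> n a b + (nimber 1 + copies (q - 1) up) + nimber k) =
      wins_first_left (position n (q - 1) (nim_sum 1 k))"
    using plus_nimber_nimber(1)[of "truncated_support \<tau> n a b + copies (q - 1) up" 1 k]
    by (simp add: position_def ac_simps)
  then show ?thesis
    unfolding position_def wins_first_right_nimber_plus[of "_ + _"] right_opts_plus_iff
      right_opts_truncated_support right_opts_copies_up
    by blast
qed

lemma not_wins_first_empty_position:
  "\<not> wins_first_left (position 0 0 0)" "\<not> wins_first_right (position 0 0 0)"
  by (simp_all add: wins_first_left_position[of 0 0 0] wins_first_right_position[of 0 0 0])

lemma not_wins_first_right_ups: "\<not> wins_first_right (position 0 q 0)"
proof -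
  have "\<not> wins_first_right (copies q up)"
    by (induction q) (simp_all add: not_wins_first_right_plus not_wins_first_right_up)
  then show ?thesis
    by (simp add: position_def truncated_support_empty_heap)
qed

text \<open>
  The first claim is about Left moving second, the second one about Left moving first. In the
  second claim, Left usually removes \<open>a\<close> pebbles, or all but one if \<open>n \<le> a\<close>; this gives
  the bounds that allow \<open>a\<close> more pebbles. Heaps of at most one pebble are played differently,
  since Left should not give up a single pebble lightly: it is a spare move for her.

  With \<open>k \<ge> 2\<close> Left can afford \<open>a\<close> pebbles more, because a move from \<open>\<up>\<close> to \<open>*\<close>
  preserves \<open>k \<ge> 2\<close>, whereas a move of Right that decreases \<open>k\<close> passes the turn to Left.
\<close>

lemma left_wins_position:
  "(1 \<le> n \<and> (n \<le> \<tau> + q * a \<or> 2 \<le> k \<and> n \<le> \<tau> + a + q * a) \<longrightarrow>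
      \<not> wins_first_right (position n q k)) \<and>
   ((n, q, k) \<noteq> (0, 0, 0) \<and> (n \<le> \<tau> + a + q * a \<or> 2 \<le> k \<and> n \<le> \<tau> + 2 * a + q * a) \<longrightarrow>
      wins_first_left (position n q k))"
proof (induction n q k rule: triple_induct)
  case (less n q k)
  have second: "\<not> wins_first_right (position n q k)"
    if n: "1 \<le> n" and bound: "n \<le> \<tau> + q * a \<or> 2 \<le> k \<and> n \<le> \<tau> + a + q * a"
  proof -
    have "wins_first_left (position n' q k)" if "n' + \<tau> + 1 \<le> n" for n'
      using less[of n' q k] that bound by (cases q) auto
    moreover have "wins_first_left (position n (q - 1) (nim_sum 1 k))" if "0 < q"
      using less[of n "q - 1" "nim_sum 1 k"] that n bound nim_sum_1_ge_2[of k]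
      by (cases q) auto
    moreover have "wins_first_left (position n q k')" if "k' < k" for k'
      using less[of n q k'] that n bound by auto
    ultimately show ?thesis
      unfolding wins_first_right_position[of n] by blast
  qed
  have first: "wins_first_left (position n q k)"
    if nz: "(n, q, k) \<noteq> (0, 0, 0)"
      and bound: "n \<le> \<tau> + a + q * a \<or> 2 \<le> k \<and> n \<le> \<tau> + 2 * a + q * a"
  proof -
    consider "n \<le> 1" "0 < k" | "n \<le> 1" "k = 0" "0 < q" | "n = 1" "k = 0" "q = 0"
      | "2 \<le> n" "n \<le> a" | "2 \<le> n" "a < n"
      using nz by force
    then show ?thesis
    proof cases
      case 1
      then have "\<not> wins_first_right (position n q 0)"
        using less[of n q 0] pos not_wins_first_right_ups[of q] by (cases "n = 0") auto
      with 1 show ?thesis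
        unfolding wins_first_left_position[of n] by blast
    next
      case 2
      then have "\<not> wins_first_right (position n (q - 1) k)"
        using less[of n "q - 1" 0] pos not_wins_first_right_ups[of "q - 1"] by (cases "n = 0") auto
      with 2 show ?thesis
        unfolding wins_first_left_position[of n] by blast
    next
      case 3
      then show ?thesis
        unfolding wins_first_left_position[of n] using pos not_wins_first_empty_position by auto
    next
      case 4
      then have "\<not> wins_first_right (position 1 q k)"
        using less[of 1 q k] pos by auto
      moreover have "1 < n" "n \<le> 1 + a"
        using 4 by auto
      ultimately show ?thesis
        unfolding wins_first_left_position[of n] by blast
    next
      case 5
      then have "\<not> wins_first_right (position (n - a) q k)"
        using less[of "n - a" q k] pos bound by auto
      moreover have "n - a < n" "n \<le> n - a + a"
        using 5 pos by auto
      ultimately show ?thesis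
        unfolding wins_first_left_position[of n] by blast
    qed
  qed
  show ?case
    using second first by blast
qed

text \<open>
  The first claim is about Right moving second, the second one about Right moving first. Right
  moving first turns \<open>\<up>\<close> into \<open>*\<close> as long as he can, then removes the nimber, and only
  moves in the heap when it is alone.
\<close>

lemma right_wins_position:
  "(a + \<tau> + 1 + (q + 1) * a \<le> n \<or> q = 0 \<and> k = 0 \<and> a + \<tau> + 1 \<le> n \<longrightarrow>
      \<not> wins_first_left (position n q k)) \<and>
   (a + \<tau> + 1 + q * a \<le> n \<longrightarrow> wins_first_right (position n q k))"
proof (induction n q k rule: triple_induct)
  case (less n q k)
  have second: "\<not> wins_first_left (position n q k)"
    if bound: "a + \<tau> + 1 + (q + 1) * a \<le> n \<or> q = 0 \<and> k = 0 \<and> a + \<tau> + 1 \<le> n"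
  proof -
    have "wins_first_right (position n' q k)" if n': "n' < n" "n \<le> n' + a" for n'
    proof (cases "a + \<tau> + 1 + q * a \<le> n'")
      case True
      then show ?thesis
        using less n' by blast
    next
      case False
      then have "q = 0" "k = 0" "0 + \<tau> + 1 \<le> n'" "n' \<le> 0 + b"
        using bound n' gap by auto
      then show ?thesis
        unfolding wins_first_right_position[of n'] using not_wins_first_empty_position by blast
    qed
    moreover have "wins_first_right (position n (q - 1) k)" if "0 < q"
      using less[of n "q - 1" k] that bound by (cases q) auto
    moreover have "wins_first_right (position n q k')" if "k' < k" for k'
      using less[of n q k'] that bound by auto
    ultimately show ?thesis
      unfolding wins_first_left_position[of n] by blast
  qed
  have first: "wins_first_right (position n q k)" if bound: "a + \<tau> + 1 + q * a \<le> n"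
  proof -
    consider "0 < q" | "q = 0" "0 < k" | "q = 0" "k = 0" "n \<le> 0 + b" | "q = 0" "k = 0" "b < n"
      by force
    then show ?thesis
    proof cases
      case 1
      then have "\<not> wins_first_left (position n (q - 1) (nim_sum 1 k))"
        using less[of n "q - 1" "nim_sum 1 k"] bound by (cases q) auto
      with 1 show ?thesis
        unfolding wins_first_right_position[of n] by blast
    next
      case 2
      then have "\<not> wins_first_left (position n q 0)"
        using less[of n q 0] bound by auto
      with 2 show ?thesis
        unfolding wins_first_right_position[of n] by blast
    next
      case 3
      moreover from this bound have "0 + \<tau> + 1 \<le> n"
        by simp
      ultimately show ?thesis
        unfolding wins_first_right_position[of n] using not_wins_first_empty_position by blast
    next
      case 4
      then have "\<not> wins_first_left (position (n - (\<tau> + 1)) q k)"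
        using less[of "n - (\<tau> + 1)" q k] gap by auto
      moreover have "n - (\<tau> + 1) + \<tau> + 1 \<le> n" "n \<le> n - (\<tau> + 1) + b"
        using 4 gap by auto
      ultimately show ?thesis
        unfolding wins_first_right_position[of n] by blast
    qed
  qed
  show ?case
    using second first by blast
qed

lemma down_wins: "\<not> wins_first_left down" "wins_first_right down"
  using not_wins_first_right_up wins_first_left.simps[of up]
  by (simp_all add: down_def left_opts_up)

text \<open>
  For \<open>p = 0\<close> there is no \<open>\<up>\<close> to cancel \<open>\<down>\<close>. If Left moves to a hot heap, Right empties it,
  which leaves \<open>\<down> + *k\<close> with \<open>k \<ge> 2\<close>. To any other move he replies so that, besides a
  heap that Left loses moving first, only \<open>\<down>\<close>, only \<open>* + *\<close> or nothing remains.
\<close>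

lemma not_wins_first_left_truncated_support_down:
  assumes "a + \<tau> + 1 \<le> n" "2 \<le> k"
  shows "\<not> wins_first_left (truncated_support \<tau> n a b + down + nimber k)"
proof -
  let ?T = "\<lambda>n. truncated_support \<tau> n a b"
  have left: "wins_first_left (?T n + down + nimber k) \<longleftrightarrow>
      (\<exists>n'<n. n \<le> n' + a \<and> \<not> wins_first_right (?T n' + down + nimber k)) \<or>
      \<not> wins_first_right (?T n + nimber 1 + nimber k) \<or>
      (\<exists>k'<k. \<not> wins_first_right (?T n + down + nimber k'))" for n k
    unfolding wins_first_left_nimber_plus[of "_ + _"] left_opts_plus_iff
      left_opts_truncated_support left_opts_down
    by auto
  have right: "wins_first_right (?T n + down + nimber k) \<longleftrightarrow>
      (\<exists>n'. n' + \<tau> + 1 \<le> n \<and> n \<le> n' + b \<and> \<not> wins_first_left (?T n' + down + nimber k)) \<or>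
      \<not> wins_first_left (?T n + nimber k) \<or>
      (\<exists>k'<k. \<not> wins_first_left (?T n + down + nimber k'))" for n k
    unfolding wins_first_right_nimber_plus[of "_ + _"] right_opts_plus_iff
      right_opts_truncated_support right_opts_down
    by auto
  have star: "wins_first_right (?T n + nimber 1 + nimber k)"
    if "\<not> wins_first_left (?T n)" "2 \<le> k" for n k
  proof -
    have "\<not> wins_first_left (?T n + nimber 1 + nimber 1)"
      using that plus_second_wins(1)[OF second_wins_nimber_double, of "?T n" 1]
      by (simp add: add.assoc)
    then show ?thesis
      unfolding wins_first_right_nimber_plus[of "_ + _"] using that by (metis Suc_1 Suc_le_lessD)
  qed
  have stop: "\<not> wins_first_left (?T n)" if "a + \<tau> + 1 \<le> n" for n
    using right_wins_position[of 0 n 0] that by (simp add: position_def)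
  have reply: "wins_first_right (?T n + down + nimber k)" if "\<not> wins_first_left (?T n)" for n k
  proof (cases "k = 0")
    case True
    with that show ?thesis
      unfolding right[of n] by simp
  next
    case False
    moreover have "\<not> wins_first_left (?T n + down + nimber 0)"
      using that down_wins not_wins_first_left_plus[of "?T n" down] by simp
    ultimately show ?thesis
      unfolding right[of n k] by blast
  qed
  have "\<not> wins_first_left (?T 0 + down + nimber k)"
    unfolding left[of 0] using star[of 0 k] reply[of 0] assms truncated_support_empty_heap by simp
  then have "wins_first_right (?T n' + down + nimber k)"
    if "n' < n" "n \<le> n' + a" for n'
  proof (cases "a + \<tau> + 1 \<le> n'")
    case True
    then show ?thesis
      by (intro reply stop)
  next
    case False
    then have "0 + \<tau> + 1 \<le> n'" "n' \<le> 0 + b"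
      using assms that gap by auto
    then show ?thesis
      unfolding right[of n'] using \<open>\<not> wins_first_left (?T 0 + down + nimber k)\<close> by blast
  qed
  then show ?thesis
    unfolding left[of n] using star reply stop assms by blast
qed

lemma truncated_support_atomic:
  assumes lower: "a + \<tau> + 1 + p * a \<le> n" and upper: "n < a + \<tau> + 1 + (p + 1) * a"
  shows "far_star_equiv (truncated_support \<tau> n a b) (copies p down)"
proof (rule far_star_equivI)
  let ?T = "truncated_support \<tau> n a b"
  define M where "M = birthday (?T + copies (Suc p) up) + birthday (?T + copies p up + down) + 2"
  have copies_down: "- copies p down = copies p up"
    by (simp add: down_def)
  have "\<not> wins_first_right (?T + copies (Suc p) up + nimber M)"
    using left_wins_position[of n "Suc p" M] lower upper by (simp add: position_def M_def)
  then have "left_second_far (?T + copies (Suc p) up)"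
    using wins_first_right_far_star[of "?T + copies (Suc p) up" M] by (simp add: M_def)
  then show "left_second_far (?T + - copies p down + up)"
    unfolding copies_down by (simp add: ac_simps)
  have "\<not> wins_first_left (?T + copies p up + down + nimber M)"
  proof (cases p)
    case 0
    then show ?thesis
      using not_wins_first_left_truncated_support_down[of n M] lower by (simp add: M_def)
  next
    case (Suc r)
    have "?T + copies p up + down + nimber M = position n r M + (up + down)"
      by (simp add: Suc position_def ac_simps)
    then show ?thesis
      using right_wins_position[of r n M] lower
      by (simp add: Suc plus_second_wins second_wins_up_down)
  qed
  then have "\<not> left_first_far (?T + copies p up + down)"
    using wins_first_left_far_star[of "?T + copies p up + down" M] by (simp add: M_def)
  then have "left_second_far (- (?T + copies p up + down))"
    by (simp only: left_second_far_uminus simp_thms)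
  then show "left_second_far (copies p down + - ?T + up)"
    by (simp add: down_def ac_simps)
qed

end

theorem theorem5:
  fixes a b \<tau> n :: nat
  assumes "0 < a" and "0 < b" and "a < b"
    and "1 \<le> \<tau>" and "real \<tau> < (real b - real a) / 2"
    and "a + \<tau> + 1 \<le> n"
  shows "has_atomic_weight (truncated_support \<tau> n a b)
           (- \<lfloor>(real n - real (a + \<tau> + 1)) / real a\<rfloor>)"
proof -
  define p where "p = (n - (a + \<tau> + 1)) div a"
  have "\<lfloor>(real n - real (a + \<tau> + 1)) / real a\<rfloor> = int p"
    using assms(6) floor_divide_of_nat_eq[of "n - (a + \<tau> + 1)" a]
    by (simp add: p_def of_nat_diff)
  moreover have "up_multiple (- int p) = copies p down"
    by (cases p) (simp_all add: up_multiple_def nat_add_distrib)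
  moreover have "real (a + 2 * \<tau>) < real b"
    using assms(5) by simp
  then have "a + 2 * \<tau> < b"
    by (simp only: of_nat_less_iff)
  moreover have "p * a \<le> n - (a + \<tau> + 1)" "n - (a + \<tau> + 1) < (p + 1) * a"
    unfolding p_def using assms(1) dividend_less_div_times[of a "n - (a + \<tau> + 1)"]
    by (simp_all add: add.commute)
  then have "a + \<tau> + 1 + p * a \<le> n" "n < a + \<tau> + 1 + (p + 1) * a"
    using assms(6) by linarith+
  ultimately show ?thesis
    using truncated_support_atomic[of a \<tau> b p n] assms(1,4) by (simp add: has_atomic_weight_def)
qed

end
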